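(* Let $A$ be a ring, let $I \subseteq A$ be an ideal, and let $t$ be an indeterminate over $A$. Let $A[It] = \bigoplus_{n \in \mathbb{N}} I^n t^n \subseteq A[t]$ be the Rees algebra of $I$, and let $A[It]^{\boxed{\#}}$ be the root closure of $A[It]$ in $A[t]$, so that $A[It] \subseteq A[It]^{\boxed{\#}} \subseteq A[t]$. Define $$S = \bigoplus_{n \in \mathbb{N}} (I^n)^{\natural} t^n = A \oplus I^{\natural} t \oplus (I^2)^{\natural} t^2 \oplus \cdots .$$ Then the subring $S$ of $A[t]$ is equal to the root closure $A[It]^{\boxed{\#}}$ of $A[It]$ in $A[t]$.
   Context: All rings are commutative with identity; $\mathbb{N}$ includes $0$ and $I^0 = A$. Root closure of rings: for an extension of rings $C \subseteq B$, $C$ is root closed in $B$ if whenever $x^n \in C$ for some $x \in B$ and some integer $n \ge 1$, then $x \in C$. The root closure of $C$ in $B$, denoted $C^{\boxed{\#}}$, is the smallest subring of $B$ which contains $C$ and is root closed in $B$. Equivalently (a known fact), $C^{\boxed{\#}} = \bigcup_{\ell \ge 1} C^{\#_\ell}$, where $C^{\#_1} = C[x \in B \mid x^n \in C \text{ for some } n \ge 1]$ and, for $\ell > 1$, $C^{\#_\ell} = C^{\#_{\ell-1}}[x \in B \mid x^n \in C^{\#_{\ell-1}} \text{ for some } n \ge 1]$. Operations on ideals: for an ideal $J$ of a ring $A$, let $J^{\#}$ be the ideal of $A$ generated by $\{x \in A \mid x^n \in J^n \text{ for some } n \ge 1\}$; let $J^{\#_1} = J^{\#}$ and $J^{\#_\ell}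 = (J^{\#_{\ell-1}})^{\#}$ for $\ell > 1$; let $J^{\boxed{\#}} = \bigcup_{\ell \ge 1} J^{\#_\ell}$; and let $J^{\natural} = \{x \in A \mid x^n \in (J^n)^{\boxed{\#}} \text{ for some } n \ge 1\}$, which is an ideal of $A$. *)

theory Defs
  imports "HOL-Algebra.UnivPoly" "HOL-Algebra.Ideal_Product" "HOL-Algebra.Subrings"
begin

section \<open>Root closure in an extension of rings\<close>

definition root_closed :: "('a, 'b) ring_scheme \<Rightarrow> 'a set \<Rightarrow> bool"
  where "root_closed B C \<longleftrightarrow>
    (\<forall>x \<in> carrier B. \<forall>n :: nat. n \<ge> 1 \<longrightarrow> x [^]\<^bsub>B\<^esub> n \<in> C \<longrightarrow> x \<in> C)"

text \<open>The smallest subring of \<open>B\<close> that contains \<open>C\<close> and is root closed in \<open>B\<close>; the two lemmas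
  below state that this intersection has these properties and is least with them.\<close>

definition root_closure :: "('a, 'b) ring_scheme \<Rightarrow> 'a set \<Rightarrow> 'a set"
  where "root_closure B C = \<Inter> {D. subring D B \<and> C \<subseteq> D \<and> root_closed B D}"

lemma root_closure_least:
  assumes "subring D B" "C \<subseteq> D" "root_closed B D"
  shows "root_closure B C \<subseteq> D"
  using assms unfolding root_closure_def by blast

lemma (in ring) root_closure_props:
  assumes "C \<subseteq> carrier R"
  shows "subring (root_closure R C) R"
    and "C \<subseteq> root_closure R C"
    and "root_closed R (root_closure R C)"
proof -
  have "carrier R \<in> {D. subring D R \<and> C \<subseteq> D \<and> root_closed R D}"
    using assms carrier_is_subring by (simp add: root_closed_def)
  then show "subring (root_closure R C) R"
    unfolding root_closure_def by (intro subring_Inter) blast+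
  show "C \<subseteq> root_closure R C"
    unfolding root_closure_def by blast
  show "root_closed R (root_closure R C)"
    unfolding root_closure_def root_closed_def by blast
qed


section \<open>Operations on ideals\<close>

text \<open>The library's monoid of ideals under the ideal product has the unit ideal as its neutral
  element, so its power operation is the usual power of ideals, with \<open>J\<^sup>0 = A\<close>.\<close>

definition ideal_pow :: "('a, 'b) ring_scheme \<Rightarrow> 'a set \<Rightarrow> nat \<Rightarrow> 'a set"
  where "ideal_pow A J n = J [^]\<^bsub>ideals_set A\<^esub> n"

lemma ideal_pow_simps:
  "ideal_pow A J 0 = carrier A"
  "ideal_pow A J (Suc n) = ideal_pow A J n \<cdot>\<^bsub>A\<^esub> J"
  by (simp_all add: ideal_pow_def nat_pow_def ideals_set_def)

definition ideal_sharp :: "('a, 'b) ring_scheme \<Rightarrow> 'a set \<Rightarrow> 'a set"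
  where "ideal_sharp A J =
    genideal A {x \<in> carrier A. \<exists>n :: nat. n \<ge> 1 \<and> x [^]\<^bsub>A\<^esub> n \<in> ideal_pow A J n}"

definition ideal_box_sharp :: "('a, 'b) ring_scheme \<Rightarrow> 'a set \<Rightarrow> 'a set"
  where "ideal_box_sharp A J = (\<Union>l \<in> {1 :: nat..}. (ideal_sharp A ^^ l) J)"

definition ideal_natural :: "('a, 'b) ring_scheme \<Rightarrow> 'a set \<Rightarrow> 'a set"
  where "ideal_natural A J =
    {x \<in> carrier A. \<exists>n :: nat. n \<ge> 1 \<and> x [^]\<^bsub>A\<^esub> n \<in> ideal_box_sharp A (ideal_pow A J n)}"


section \<open>Graded subsets of the polynomial ring\<close>

text \<open>For ideals \<open>J n\<close> of \<open>A\<close>, the direct sum of the \<open>J n t\<^sup>n\<close> inside \<open>A[t]\<close> consists of the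
  polynomials whose coefficient of \<open>t\<^sup>n\<close> lies in \<open>J n\<close> for every \<open>n\<close>.\<close>

definition graded_sum :: "('a, 'b) ring_scheme \<Rightarrow> (nat \<Rightarrow> 'a set) \<Rightarrow> (nat \<Rightarrow> 'a) set"
  where "graded_sum A J = {f \<in> carrier (UP A). \<forall>n. coeff (UP A) f n \<in> J n}"

definition rees_algebra :: "('a, 'b) ring_scheme \<Rightarrow> 'a set \<Rightarrow> (nat \<Rightarrow> 'a) set"
  where "rees_algebra A I = graded_sum A (ideal_pow A I)"

end

theory Submission
  imports Defs "HOL-Computational_Algebra.Primes"
begin

text \<open>
  Write \<open>S\<close> for the direct sum of the \<open>(I\<^sup>n)\<^sup>\<natural> t\<^sup>n\<close>.

  Every root closed subring \<open>D\<close> that contains the Rees algebra contains \<open>S\<close>: if \<open>K t\<^sup>n \<subseteq> D\<close> for an ideal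
  \<open>K\<close>, then an element \<open>y\<close> with \<open>y\<^sup>k \<in> K\<^sup>k\<close> satisfies \<open>(y t\<^sup>n)\<^sup>k \<in> D\<close>, so \<open>y t\<^sup>n \<in> D\<close>; this passes to the ideal
  generated by such \<open>y\<close>, to all iterates of the sharp operation and, by one more root, to the natural
  closure (\<open>monom_natural_mem\<close>).

  Conversely \<open>S\<close> is a subring, as the natural closures of ideals are closed under sums and compatible
  with products (\<open>natural_add\<close>, \<open>natural_mult\<close>), and it contains every homogeneous polynomial with a
  power in \<open>S\<close>, which is built into the definition of the natural closure (\<open>natural_root\<close>). What
  remains is that a graded subring \<open>S\<close> which is root closed for homogeneous elements is root closed
  (\<open>graded_sum_root_closed\<close>).

  For this it suffices to treat \<open>g\<^sup>p \<in> S\<close> with \<open>p\<close> prime. Let \<open>b\<close> be the lowest term of \<open>g\<close>. Its \<open>p\<close>-th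
  power is the lowest term of \<open>g\<^sup>p\<close>, so \<open>b \<in> S\<close>. It is enough to show \<open>(g - b)\<^sup>p \<in> S\<close>, for then the argument
  continues with \<open>g - b\<close>. All mixed terms in the binomial expansion of \<open>(g - b)\<^sup>p\<close> are multiples of \<open>p b\<close>
  times powers of \<open>g\<close>, so the point is that \<open>e = p b\<close> multiplies all powers of \<open>g\<close> into \<open>S\<close>
  (\<open>root_conductor\<close>). After inverting \<open>e\<close>, the components of \<open>g\<close> are determined recursively by those of
  \<open>g\<^sup>p\<close>, so some power of \<open>e\<close> multiplies \<open>g\<close> into \<open>S\<close> (\<open>root_localized\<close>). Since \<open>g\<^sup>p \<in> S\<close>, a single power
  \<open>e\<^sup>M\<close> does so for all powers of \<open>g\<close>. Elements with such a bound form a graded subring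
  (\<open>almost_integral_subring\<close>, \<open>almost_integral_lowest_term\<close>), so the components \<open>w\<close> of each \<open>g\<^sup>i\<close> have
  bounded denominators as well. A high power of \<open>e w\<close> then lies in \<open>S\<close>, and \<open>e w\<close> is homogeneous, so
  \<open>e w \<in> S\<close>.
\<close>

section \<open>Powers of sums and subrings\<close>

lemma (in cring) binomial:
  assumes x: "x \<in> carrier R" and y: "y \<in> carrier R"
  shows "(x \<oplus> y) [^] n = (\<Oplus>k \<in> {..n::nat}. [(n choose k)] \<cdot> (x [^] k \<otimes> y [^] (n - k)))"
proof (induct n)
  case 0
  then show ?case by simp
next
  case (Suc n)
  define T where "T m k = [(m choose k)] \<cdot> (x [^] k \<otimes> y [^] (m - k))" for m k :: nat
  have T: "T m k \<in> carrier R" for m k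
    using x y by (simp add: T_def)
  have pascal: "T (Suc n) (Suc k) = x \<otimes> T n k \<oplus> y \<otimes> T n (Suc k)" if "k \<le> n" for k
  proof (cases "k = n")
    case True
    then show ?thesis using x y by (simp add: T_def m_comm binomial_eq_0)
  next
    case False
    with that have "n - k = Suc (n - Suc k)" by simp
    then have "x \<otimes> T n k = [(n choose k)] \<cdot> (x [^] Suc k \<otimes> y [^] (n - k))"
      and "y \<otimes> T n (Suc k) = [(n choose Suc k)] \<cdot> (x [^] Suc k \<otimes> y [^] (n - k))"
      using x y by (simp_all add: T_def add_pow_rdistr m_ac)
    then show ?thesis using x y by (simp add: T_def add.nat_pow_mult add.commute)
  qed
  have top: "T n (Suc n) = \<zero>" and bot: "T (Suc n) 0 = y \<otimes> T n 0"
    using x y by (simp_all add: T_def m_comm binomial_eq_0)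
  have "(\<Oplus>k \<in> {..Suc n}. T (Suc n) k)
      = (\<Oplus>k \<in> {..n}. x \<otimes> T n k \<oplus> y \<otimes> T n (Suc k)) \<oplus> y \<otimes> T n 0"
    using T x y by (simp add: finsum_Suc2 pascal bot del: finsum_Suc cong: finsum_cong)
  also have "\<dots> = (\<Oplus>k \<in> {..n}. x \<otimes> T n k) \<oplus> ((\<Oplus>k \<in> {..n}. y \<otimes> T n (Suc k)) \<oplus> y \<otimes> T n 0)"
    using T x y by (simp add: finsum_addf a_assoc)
  also have "(\<Oplus>k \<in> {..n}. y \<otimes> T n (Suc k)) \<oplus> y \<otimes> T n 0 = (\<Oplus>k \<in> {..Suc n}. y \<otimes> T n k)"
    using T x y by (simp add: finsum_Suc2 del: finsum_Suc)
  also have "\<dots> = (\<Oplus>k \<in> {..n}. y \<otimes> T n k)"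
    using T x y by (simp add: top)
  also have "(\<Oplus>k \<in> {..n}. x \<otimes> T n k) \<oplus> (\<Oplus>k \<in> {..n}. y \<otimes> T n k) = (x \<oplus> y) \<otimes> (\<Oplus>k \<in> {..n}. T n k)"
    using T x y by (simp add: finsum_rdistr l_distr)
  also have "\<dots> = (x \<oplus> y) [^] Suc n"
    using Suc x y T by (simp add: T_def m_comm)
  finally show ?case by (simp add: T_def)
qed

text \<open>Expanding a power of a sum one factor at a time keeps membership in any additively closed
  set without mentioning the binomial coefficients.\<close>

lemma (in cring) pow_add_mem:
  assumes X: "\<And>u v. u \<in> X \<Longrightarrow> v \<in> X \<Longrightarrow> u \<oplus> v \<in> X"
    and x: "x \<in> carrier R" and y: "y \<in> carrier R"
    and mon: "\<And>i j. i + j = N \<Longrightarrow> x [^] i \<otimes> y [^] j \<in> X"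
  shows "(x \<oplus> y) [^] (N::nat) \<in> X"
proof -
  have "x [^] i \<otimes> y [^] j \<otimes> (x \<oplus> y) [^] n \<in> X" if "i + j + n = N" for i j n :: nat
    using that
  proof (induct n arbitrary: i j)
    case 0
    then show ?case using mon x y by simp
  next
    case (Suc n)
    have "x [^] i \<otimes> y [^] j \<otimes> (x \<oplus> y) [^] Suc n
        = x [^] Suc i \<otimes> y [^] j \<otimes> (x \<oplus> y) [^] n \<oplus> x [^] i \<otimes> y [^] Suc j \<otimes> (x \<oplus> y) [^] n"
    proof -
      define z where "z = (x \<oplus> y) [^] n"
      have "z \<in> carrier R" using x y by (simp add: z_def)
      then have "x [^] i \<otimes> y [^] j \<otimes> (z \<otimes> (x \<oplus> y))
        = x [^] i \<otimes> x \<otimes> y [^] j \<otimes> z \<oplus> x [^] i \<otimes> (y [^] j \<otimes> y) \<otimes> z"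
        using x y by (simp add: r_distr m_ac)
      then show ?thesis by (simp add: z_def)
    qed
    moreover have "x [^] Suc i \<otimes> y [^] j \<otimes> (x \<oplus> y) [^] n \<in> X"
      by (rule Suc.hyps) (use Suc.prems in simp)
    moreover have "x [^] i \<otimes> y [^] Suc j \<otimes> (x \<oplus> y) [^] n \<in> X"
      by (rule Suc.hyps) (use Suc.prems in simp)
    ultimately show ?case using X by metis
  qed
  from this[of 0 0 N] show ?thesis using x y by simp
qed

lemma (in ring) subring_nat_pow:
  assumes "subring S R" "x \<in> S" shows "x [^] (n::nat) \<in> S"
  by (induct n) (use assms subringE[OF assms(1)] in auto)

lemma (in ring) subring_add_pow:
  assumes "subring S R" "x \<in> S" shows "[(n::nat)] \<cdot> x \<in> S"
  by (induct n) (use assms subringE[OF assms(1)] in auto)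

lemma (in ring) subring_minus:
  assumes "subring S R" "x \<in> S" "y \<in> S" shows "x \<ominus> y \<in> S"
  using assms subringE[OF assms(1)] by (simp add: a_minus_def)

lemma (in ring) subring_finsum:
  assumes "subring S R" "\<And>i. i \<in> F \<Longrightarrow> f i \<in> S" shows "finsum R f F \<in> S"
proof (cases "finite F")
  case True
  then show ?thesis using assms(2)
  proof (induct F)
    case (insert a F)
    then have "finsum R f (insert a F) = f a \<oplus> finsum R f F"
      using subringE(1)[OF assms(1)] by (intro finsum_insert) auto
    then show ?case using insert subringE(7)[OF assms(1)] by auto
  qed (use subringE[OF assms(1)] in auto)
qed (use subringE[OF assms(1)] in \<open>auto simp: finsum_infinite\<close>)

text \<open>Membership passes from \<open>x\<^sup>p\<close> to \<open>(x + y)\<^sup>p\<close> although the mixed monomials need not lie in \<open>S\<close>: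
  for prime \<open>p\<close> the mixed binomial coefficients are divisible by \<open>p\<close>, so it is enough to have
  \<open>p\<close> times these monomials in \<open>S\<close>.\<close>

lemma (in cring) subring_prime_pow_add:
  assumes S: "subring S R" and p: "prime (p::nat)"
    and x: "x \<in> carrier R" and y: "y \<in> carrier R"
    and mixed: "\<And>i j. [p] \<cdot> (x [^] Suc i \<otimes> y [^] Suc (j :: nat)) \<in> S"
    and pure: "x [^] p \<in> S" "y [^] p \<in> S"
  shows "(x \<oplus> y) [^] p \<in> S"
proof -
  have "[(p choose k)] \<cdot> (x [^] k \<otimes> y [^] (p - k)) \<in> S" if k: "k \<le> p" for k
  proof (cases "k = 0 \<or> k = p")
    case True
    then show ?thesis using pure x y by auto
  next
    case False
    with k obtain i j where ij: "k = Suc i" "p - k = Suc j"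
      by (metis Suc_diff_Suc le_neq_implies_less not0_implies_Suc)
    have "p dvd (p choose k)"
      using False k p by (intro dvd_choose_prime) auto
    then obtain c where "p choose k = p * c" by blast
    then have "[(p choose k)] \<cdot> (x [^] k \<otimes> y [^] (p - k)) = [c] \<cdot> ([p] \<cdot> (x [^] Suc i \<otimes> y [^] Suc j))"
      using x y ij by (simp add: add.nat_pow_pow)
    then show ?thesis using subring_add_pow[OF S mixed] by simp
  qed
  then have "(\<Oplus>k \<in> {..p}. [(p choose k)] \<cdot> (x [^] k \<otimes> y [^] (p - k))) \<in> S"
    by (intro subring_finsum[OF S]) simp
  then show ?thesis by (simp only: binomial[OF x y])
qed

lemma (in cring) add_pow_nat_pow:
  assumes x: "x \<in> carrier R"
  shows "([(k::nat)] \<cdot> x) [^] (n::nat) = [(k ^ n)] \<cdot> (x [^] n)"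
proof (induct n)
  case 0
  then show ?case using x by simp
next
  case (Suc n)
  have "([k] \<cdot> x) [^] Suc n = [(k ^ n)] \<cdot> (x [^] n) \<otimes> [k] \<cdot> x"
    by (simp only: nat_pow_Suc Suc)
  also have "\<dots> = [(k ^ n)] \<cdot> ([k] \<cdot> (x [^] Suc n))"
    using x by (simp only: add_pow_ldistr add_pow_rdistr nat_pow_Suc nat_pow_closed add.nat_pow_closed m_closed add.nat_pow_pow mult.commute)
  also have "\<dots> = [(k ^ Suc n)] \<cdot> (x [^] Suc n)"
    using x by (simp only: add.nat_pow_pow nat_pow_closed power_Suc)
  finally show ?case .
qed

section \<open>Localization and almost integrality at one element\<close>

text \<open>For \<open>e \<in> S\<close> this is the preimage of \<open>S[1/e]\<close> under the map \<open>R \<rightarrow> R[1/e]\<close>; as \<open>e\<close> may be a zero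
  divisor, that map need not be injective.\<close>

definition (in ring) localized :: "'a set \<Rightarrow> 'a \<Rightarrow> 'a set"
  where "localized S e = {x \<in> carrier R. \<exists>M::nat. e [^] M \<otimes> x \<in> S}"

text \<open>The elements all of whose powers have a bounded power of \<open>e\<close> as a common denominator. This is
  almost integrality over \<open>S\<close> with denominators restricted to the powers of \<open>e\<close>.\<close>

definition (in ring) almost_integral :: "'a set \<Rightarrow> 'a \<Rightarrow> 'a set"
  where "almost_integral S e = {x \<in> carrier R. \<exists>M::nat. \<forall>N::nat. e [^] M \<otimes> x [^] N \<in> S}"

lemma (in ring) subset_localized:
  assumes S: "subring S R" shows "S \<subseteq> localized S e"
proof
  fix x assume x: "x \<in> S"
  then have "x \<in> carrier R" using subringE(1)[OF S] by auto
  moreover from this x have "e [^] (0::nat) \<otimes> x \<in> S" by simp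
  ultimately show "x \<in> localized S e" unfolding localized_def by blast
qed

lemma (in cring) localized_subring:
  assumes S: "subring S R" and e: "e \<in> S"
  shows "subring (localized S e) R"
proof (rule subringI)
  note SE = subringE[OF S]
  have ec: "e \<in> carrier R" using SE e by auto
  show "localized S e \<subseteq> carrier R" by (auto simp: localized_def)
  have "e [^] (0::nat) \<otimes> \<one> \<in> S" using SE by simp
  then show "\<one> \<in> localized S e" unfolding localized_def by blast
next
  note SE = subringE[OF S]
  have ec: "e \<in> carrier R" using SE e by auto
  fix x assume "x \<in> localized S e"
  then obtain M :: nat where x: "x \<in> carrier R" and M: "e [^] M \<otimes> x \<in> S" 
    by (auto simp: localized_def)
  have "e [^] M \<otimes> (\<ominus> x) = \<ominus> (e [^] M \<otimes> x)" using ec x by (simp add: r_minus)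
  then have "e [^] M \<otimes> (\<ominus> x) \<in> S" using M SE by simp
  then show "\<ominus> x \<in> localized S e" using x unfolding localized_def by blast
next
  note SE = subringE[OF S]
  have ec: "e \<in> carrier R" using SE e by auto
  fix x y assume "x \<in> localized S e" "y \<in> localized S e"
  then obtain M N :: nat where x: "x \<in> carrier R" and M: "e [^] M \<otimes> x \<in> S" 
    and y: "y \<in> carrier R" and N: "e [^] N \<otimes> y \<in> S"
    by (auto simp: localized_def)
  have eM: "e [^] M \<in> S" "e [^] N \<in> S" using subring_nat_pow[OF S e] by auto
  have "e [^] (M + N) \<otimes> (x \<otimes> y) = (e [^] M \<otimes> x) \<otimes> (e [^] N \<otimes> y)"
    using ec x y by (simp add: nat_pow_mult[symmetric] m_ac)
  then have "e [^] (M + N) \<otimes> (x \<otimes> y) \<in> S" using M N SE by simp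
  then show "x \<otimes> y \<in> localized S e" using x y unfolding localized_def by blast
  have "e [^] (M + N) \<otimes> (x \<oplus> y) = e [^] N \<otimes> (e [^] M \<otimes> x) \<oplus> e [^] M \<otimes> (e [^] N \<otimes> y)"
    using ec x y by (simp add: nat_pow_mult[symmetric] m_ac r_distr)
  then have "e [^] (M + N) \<otimes> (x \<oplus> y) \<in> S" using M N SE eM by simp
  then show "x \<oplus> y \<in> localized S e" using x y unfolding localized_def by blast
qed

lemma (in cring) subset_almost_integral:
  assumes S: "subring S R" shows "S \<subseteq> almost_integral S e"
proof
  fix x assume x: "x \<in> S"
  have "e [^] (0::nat) \<otimes> x [^] N \<in> S" for N :: nat
    using subring_nat_pow[OF S x, of N] subringE(1)[OF S] by auto
  then show "x \<in> almost_integral S e"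
    using x subringE(1)[OF S] unfolding almost_integral_def by blast
qed

lemma (in cring) almost_integral_subring:
  assumes S: "subring S R" and e: "e \<in> S"
  shows "subring (almost_integral S e) R"
proof -
  note SE = subringE[OF S]
  have ec: "e \<in> carrier R" using SE e by auto
  have mult: "x \<otimes> y \<in> almost_integral S e" and add: "x \<oplus> y \<in> almost_integral S e"
    if xy: "x \<in> almost_integral S e" "y \<in> almost_integral S e" for x y
  proof -
    from xy obtain M N :: nat where x: "x \<in> carrier R" and M: "\<And>k::nat. e [^] M \<otimes> x [^] k \<in> S" 
      and y: "y \<in> carrier R" and N: "\<And>k::nat. e [^] N \<otimes> y [^] k \<in> S"
      by (auto simp: almost_integral_def)
    have mon: "e [^] (M + N) \<otimes> (x [^] i \<otimes> y [^] j) \<in> S" for i j :: nat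
    proof -
      have "e [^] (M + N) \<otimes> (x [^] i \<otimes> y [^] j) = (e [^] M \<otimes> x [^] i) \<otimes> (e [^] N \<otimes> y [^] j)"
        using ec x y by (simp add: nat_pow_mult[symmetric] m_ac)
      then show ?thesis using M N SE by simp
    qed
    then have "e [^] (M + N) \<otimes> (x \<otimes> y) [^] k \<in> S" for k :: nat
      using x y by (simp add: nat_pow_distrib)
    then show "x \<otimes> y \<in> almost_integral S e"
      using x y unfolding almost_integral_def by blast
    have "(x \<oplus> y) [^] k \<in> {z \<in> carrier R. e [^] (M + N) \<otimes> z \<in> S}" for k :: nat
      using x y ec mon SE by (intro pow_add_mem) (auto simp: r_distr)
    then show "x \<oplus> y \<in> almost_integral S e"
      using x y unfolding almost_integral_def by blast
  qed
  have neg1: "\<ominus> \<one> \<in> almost_integral S e"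
    using subset_almost_integral[OF S] SE by blast
  show ?thesis
  proof (rule subringI)
    show "almost_integral S e \<subseteq> carrier R" by (auto simp: almost_integral_def)
    show "\<one> \<in> almost_integral S e"
      using subset_almost_integral[OF S] SE by blast
    fix x assume x: "x \<in> almost_integral S e"
    then have "\<ominus> x = (\<ominus> \<one>) \<otimes> x" by (simp add: almost_integral_def l_minus)
    then show "\<ominus> x \<in> almost_integral S e" using mult[OF neg1 x] by simp
  qed (use mult add in auto)
qed

text \<open>If \<open>x\<^sup>p \<in> S\<close>, then every power of \<open>x\<close> is an \<open>S\<close>-multiple of one of the finitely many powers
  \<open>x\<^sup>r\<close> with \<open>r < p\<close>, and these have a common denominator.\<close>

lemma (in cring) localized_root_almost_integral:
  assumes S: "subring S R" and e: "e \<in> S" and x: "x \<in> localized S e"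
    and root: "x [^] p \<in> S" and p: "(p::nat) > 0"
  shows "x \<in> almost_integral S e"
proof -
  note SE = subringE[OF S]
  have ec: "e \<in> carrier R" using SE e by auto
  from x obtain M :: nat where xc: "x \<in> carrier R" and M: "e [^] M \<otimes> x \<in> S" 
    by (auto simp: localized_def)
  have small: "e [^] (M * p) \<otimes> x [^] r \<in> S" if "r \<le> p" for r :: nat
  proof -
    from that have "M * p = M * (p - r) + M * r" by (metis add_mult_distrib2 le_add_diff_inverse2)
    then have "e [^] (M * p) \<otimes> x [^] r = e [^] (M * (p - r)) \<otimes> (e [^] M \<otimes> x) [^] r"
      using ec xc by (simp add: nat_pow_mult[symmetric] nat_pow_pow nat_pow_distrib m_ac)
    then show ?thesis using subring_nat_pow[OF S] M e SE by simp
  qed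
  have "e [^] (M * p) \<otimes> x [^] N \<in> S" for N :: nat
  proof -
    have "x [^] N = x [^] (N mod p) \<otimes> (x [^] p) [^] (N div p)"
      using xc by (simp add: nat_pow_pow nat_pow_mult)
    then have "e [^] (M * p) \<otimes> x [^] N = (e [^] (M * p) \<otimes> x [^] (N mod p)) \<otimes> (x [^] p) [^] (N div p)"
      using xc ec by (simp add: m_assoc)
    moreover have "N mod p \<le> p" using p by (simp add: less_imp_le)
    ultimately show ?thesis using small subring_nat_pow[OF S root] SE by simp
  qed
  then show ?thesis using xc unfolding almost_integral_def by blast
qed

section \<open>Lowest terms of polynomials\<close>

text \<open>The value \<open>a\<close> may be \<open>\<zero>\<close>, so the relation only says that \<open>f\<close> has order at least \<open>d\<close> and
  records its coefficient there. This makes it additive and multiplicative over rings with zero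
  divisors.\<close>

definition (in UP) lowest_term :: "nat \<Rightarrow> (nat \<Rightarrow> 'a) \<Rightarrow> 'a \<Rightarrow> bool"
  where "lowest_term d f a \<longleftrightarrow>
    f \<in> carrier P \<and> (\<forall>i<d. coeff P f i = \<zero>) \<and> coeff P f d = a"

context UP_cring
begin

lemma lowest_term_carrier: "lowest_term d f a \<Longrightarrow> a \<in> carrier R"
  by (auto simp: lowest_term_def)

lemma lowest_term_monom: "a \<in> carrier R \<Longrightarrow> lowest_term d (monom P a d) a"
  by (simp add: lowest_term_def)

lemma lowest_term_add:
  "lowest_term d f a \<Longrightarrow> lowest_term d g b \<Longrightarrow> lowest_term d (f \<oplus>\<^bsub>P\<^esub> g) (a \<oplus> b)"
  by (auto simp: lowest_term_def)

lemma lowest_term_mult: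
  assumes f: "lowest_term d f a" and g: "lowest_term e g b"
  shows "lowest_term (d + e) (f \<otimes>\<^bsub>P\<^esub> g) (a \<otimes> b)"
proof -
  have fg: "f \<in> carrier P" "g \<in> carrier P" using f g by (auto simp: lowest_term_def)
  have summand: "coeff P f i \<otimes> coeff P g (n - i) = (if n = d + e \<and> d = i then a \<otimes> b else \<zero>)"
    if "n \<le> d + e" "i \<le> n" for n i
  proof (cases "i < d")
    case True
    then show ?thesis using f fg by (simp add: lowest_term_def)
  next
    case False
    show ?thesis
    proof (cases "n - i < e")
      case True
      then have "coeff P g (n - i) = \<zero>" using g by (simp add: lowest_term_def)
      then show ?thesis using True fg by auto
    next
      case False
      with \<open>\<not> i < d\<close> that have "i = d" "n = d + e" by auto
      then show ?thesis using f g by (simp add: lowest_term_def)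
    qed
  qed
  have "coeff P (f \<otimes>\<^bsub>P\<^esub> g) n = (\<Oplus>i \<in> {..n}. if n = d + e \<and> d = i then a \<otimes> b else \<zero>)"
    if "n \<le> d + e" for n
  proof -
    have "(\<Oplus>i \<in> {..n}. coeff P f i \<otimes> coeff P g (n - i))
        = (\<Oplus>i \<in> {..n}. if n = d + e \<and> d = i then a \<otimes> b else \<zero>)"
      using that summand lowest_term_carrier[OF f] lowest_term_carrier[OF g]
      by (intro R.finsum_cong') auto
    then show ?thesis using fg by simp
  qed
  note coeff = this
  have "coeff P (f \<otimes>\<^bsub>P\<^esub> g) n = \<zero>" if "n < d + e" for n
    using coeff[of n] that by simp
  moreover have "coeff P (f \<otimes>\<^bsub>P\<^esub> g) (d + e) = a \<otimes> b"
    using coeff[of "d + e"] lowest_term_carrier[OF f] lowest_term_carrier[OF g]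
      R.finsum_singleton[of d "{..d + e}" "\<lambda>_. a \<otimes> b"] by simp
  ultimately show ?thesis using fg by (simp add: lowest_term_def)
qed

lemma lowest_term_pow:
  assumes "lowest_term d f a"
  shows "lowest_term (d * n) (f [^]\<^bsub>P\<^esub> n) (a [^] n)"
proof (induct n)
  case 0
  then show ?case by (simp add: lowest_term_def)
next
  case (Suc n)
  then show ?case using lowest_term_mult[OF Suc assms] by (simp add: add.commute)
qed

text \<open>If \<open>f = g + r\<close> with \<open>r\<close> of order \<open>j\<close>, then \<open>f\<close> and \<open>g\<close> both start with \<open>c t\<^sup>d\<close>, and the term of
  \<open>f\<^bsup>n + 1\<^esup> - g\<^bsup>n + 1\<^esup>\<close> that is linear in \<open>r\<close> dominates; the coefficient \<open>(n + 1) c\<^sup>n a\<close> is the derivative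
  of the power map at \<open>c\<close>, applied to \<open>a\<close>.\<close>

lemma lowest_term_pow_diff:
  assumes f: "lowest_term d f c" and g: "lowest_term d g c"
    and fg: "lowest_term j (f \<ominus>\<^bsub>P\<^esub> g) a"
  shows "lowest_term (d * n + j) (f [^]\<^bsub>P\<^esub> Suc n \<ominus>\<^bsub>P\<^esub> g [^]\<^bsub>P\<^esub> Suc n) ([Suc n] \<cdot> (c [^] n \<otimes> a))"
proof (induct n)
  case 0
  then show ?case using fg f g lowest_term_carrier[OF fg] by (auto simp: lowest_term_def)
next
  case (Suc n)
  have carr: "f \<in> carrier P" "g \<in> carrier P" "c \<in> carrier R" "a \<in> carrier R"
    using f g lowest_term_carrier[OF f] lowest_term_carrier[OF fg] by (auto simp: lowest_term_def)
  define x where "x = f [^]\<^bsub>P\<^esub> Suc n"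
  define y where "y = g [^]\<^bsub>P\<^esub> Suc n"
  have xy: "x \<in> carrier P" "y \<in> carrier P" using carr by (auto simp: x_def y_def)
  have "f \<otimes>\<^bsub>P\<^esub> (x \<ominus>\<^bsub>P\<^esub> y) \<oplus>\<^bsub>P\<^esub> (f \<ominus>\<^bsub>P\<^esub> g) \<otimes>\<^bsub>P\<^esub> y = x \<otimes>\<^bsub>P\<^esub> f \<ominus>\<^bsub>P\<^esub> y \<otimes>\<^bsub>P\<^esub> g"
    using xy carr by algebra
  moreover have "lowest_term (d + (d * n + j)) (f \<otimes>\<^bsub>P\<^esub> (x \<ominus>\<^bsub>P\<^esub> y))
      (c \<otimes> ([Suc n] \<cdot> (c [^] n \<otimes> a)))"
    unfolding x_def y_def by (rule lowest_term_mult[OF f Suc])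
  moreover have "lowest_term (j + d * Suc n) ((f \<ominus>\<^bsub>P\<^esub> g) \<otimes>\<^bsub>P\<^esub> y) (a \<otimes> c [^] Suc n)"
    unfolding y_def by (rule lowest_term_mult[OF fg lowest_term_pow[OF g]])
  moreover have "c \<otimes> ([Suc n] \<cdot> (c [^] n \<otimes> a)) \<oplus> a \<otimes> c [^] Suc n
      = [Suc (Suc n)] \<cdot> (c [^] Suc n \<otimes> a)"
  proof -
    have "c \<otimes> ([Suc n] \<cdot> (c [^] n \<otimes> a)) = [Suc n] \<cdot> (c [^] Suc n \<otimes> a)"
      using carr by (simp only: R.add_pow_rdistr R.m_closed R.nat_pow_closed) (simp add: R.m_ac)
    then show ?thesis using carr by (simp add: R.m_ac)
  qed
  moreover have "d + (d * n + j) = d * Suc n + j" "j + d * Suc n = d * Suc n + j" by simp_all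
  ultimately have "lowest_term (d * Suc n + j) (x \<otimes>\<^bsub>P\<^esub> f \<ominus>\<^bsub>P\<^esub> y \<otimes>\<^bsub>P\<^esub> g)
      ([Suc (Suc n)] \<cdot> (c [^] Suc n \<otimes> a))"
    using lowest_term_add by metis
  then show ?case by (simp only: x_def y_def P.nat_pow_Suc)
qed

text \<open>Subtracting the lowest terms one after another reaches every homogeneous component. Hence a
  subring is graded as soon as it is closed under lowest terms, and lowest terms, unlike arbitrary
  components, are compatible with products and powers.\<close>

lemma components_mem:
  assumes T: "subring T P"
    and low: "\<And>d f a. f \<in> T \<Longrightarrow> lowest_term d f a \<Longrightarrow> monom P a d \<in> T"
    and f: "f \<in> T"
  shows "monom P (coeff P f d) d \<in> T"
proof -
  have fc: "f \<in> carrier P" using f subringE(1)[OF T] by auto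
  have "\<exists>g \<in> T. (\<forall>i<d. coeff P g i = \<zero>) \<and> (\<forall>i\<ge>d. coeff P g i = coeff P f i)"
  proof (induct d)
    case 0
    then show ?case using f by auto
  next
    case (Suc d)
    then obtain g where g: "g \<in> T" "\<And>i. i < d \<Longrightarrow> coeff P g i = \<zero>"
      "\<And>i. i \<ge> d \<Longrightarrow> coeff P g i = coeff P f i" by auto
    have gc: "g \<in> carrier P" using g subringE(1)[OF T] by auto
    have "lowest_term d g (coeff P g d)" using g gc by (simp add: lowest_term_def)
    then have "monom P (coeff P g d) d \<in> T" by (rule low[OF g(1)])
    then have "g \<ominus>\<^bsub>P\<^esub> monom P (coeff P g d) d \<in> T"
      using P.subring_minus[OF T g(1)] by blast
    moreover have "coeff P (g \<ominus>\<^bsub>P\<^esub> monom P (coeff P g d) d) i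
        = (if i < Suc d then \<zero> else coeff P f i)" for i
      using gc g(2)[of i] g(3)[of i] fc
      by (cases i d rule: linorder_cases) (auto simp: a_minus_def R.r_neg R.minus_zero)
    ultimately show ?case
      by (intro bexI[of _ "g \<ominus>\<^bsub>P\<^esub> monom P (coeff P g d) d"]) auto
  qed
  then obtain g where "g \<in> T" "\<forall>i<d. coeff P g i = \<zero>" "coeff P g d = coeff P f d" by auto
  then show ?thesis
    using low[of g d "coeff P g d"] subringE(1)[OF T] by (auto simp: lowest_term_def)
qed

lemma mem_if_components_mem:
  assumes T: "subring T P" and f: "f \<in> carrier P"
    and comp: "\<And>d. monom P (coeff P f d) d \<in> T"
  shows "f \<in> T"
proof -
  have "(\<Oplus>\<^bsub>P\<^esub> i \<in> {..deg R f}. monom P (coeff P f i) i) \<in> T"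
    by (rule P.subring_finsum[OF T comp])
  then show ?thesis by (simp only: up_repr[OF f])
qed

end

section \<open>Root closedness of graded subrings\<close>

locale graded_subalgebra = UP_cring R P for R (structure) and P (structure) +
  fixes J :: "nat \<Rightarrow> 'a set"
  assumes J_additive: "additive_subgroup (J n) R"
    and J_mult: "a \<in> J m \<Longrightarrow> b \<in> J n \<Longrightarrow> a \<otimes> b \<in> J (m + n)"
    and J_one: "\<one> \<in> J 0"
begin

abbreviation S where "S \<equiv> graded_sum R J"

lemma graded_sum_iff: "f \<in> S \<longleftrightarrow> f \<in> carrier P \<and> (\<forall>n. coeff P f n \<in> J n)"
  by (simp add: graded_sum_def P_def)

lemma J_carrier: "a \<in> J n \<Longrightarrow> a \<in> carrier R"
  using additive_subgroup.a_subset[OF J_additive] by blast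

lemma J_zero: "\<zero> \<in> J n"
  using additive_subgroup.zero_closed[OF J_additive] by blast

lemma J_finsum:
  assumes "\<And>i. i \<in> F \<Longrightarrow> f i \<in> J n" shows "finsum R f F \<in> J n"
proof (cases "finite F")
  case True
  then show ?thesis using assms
  proof (induct F)
    case (insert a F)
    then have "finsum R f (insert a F) = f a \<oplus> finsum R f F"
      using J_carrier by (intro R.finsum_insert) auto
    then show ?case using insert additive_subgroup.a_closed[OF J_additive] by auto
  qed (use J_zero in auto)
qed (use J_zero in \<open>auto simp: R.finsum_infinite\<close>)

lemma S_subring: "subring S P"
proof (rule P.subringI)
  show "S \<subseteq> carrier P" by (auto simp: graded_sum_iff)
  show "\<one>\<^bsub>P\<^esub> \<in> S" using J_one J_zero by (auto simp: graded_sum_iff)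
next
  fix f assume "f \<in> S"
  then show "\<ominus>\<^bsub>P\<^esub> f \<in> S"
    using additive_subgroup.a_inv_closed[OF J_additive] by (auto simp: graded_sum_iff)
next
  fix f g assume fg: "f \<in> S" "g \<in> S"
  then show "f \<oplus>\<^bsub>P\<^esub> g \<in> S"
    using additive_subgroup.a_closed[OF J_additive] by (auto simp: graded_sum_iff)
  have "coeff P f i \<otimes> coeff P g (n - i) \<in> J n" if "i \<le> n" for i n
    using J_mult[of "coeff P f i" i "coeff P g (n - i)" "n - i"] fg that
    by (simp add: graded_sum_iff)
  then show "f \<otimes>\<^bsub>P\<^esub> g \<in> S" using fg by (auto simp: graded_sum_iff intro: J_finsum)
qed

lemma monom_mem_iff:
  assumes "a \<in> carrier R" shows "monom P a n \<in> S \<longleftrightarrow> a \<in> J n"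
  using assms J_zero by (auto simp: graded_sum_iff split: if_splits)

lemma lowest_term_mem:
  assumes "f \<in> S" "lowest_term d f a" shows "monom P a d \<in> S"
  using assms by (subst monom_mem_iff) (auto simp: graded_sum_iff lowest_term_def)


text \<open>As \<open>e\<close> is homogeneous, clearing denominators commutes with taking lowest terms. So both
  closures of \<open>S\<close> with respect to \<open>e\<close> are graded again.\<close>

lemma localized_lowest_term:
  assumes e: "e = monom P c q" and c: "c \<in> carrier R"
    and f: "f \<in> P.localized S e" and low: "lowest_term d f a"
  shows "monom P a d \<in> P.localized S e"
proof -
  have a: "a \<in> carrier R" using low by (rule lowest_term_carrier)
  from f obtain M :: nat where "e [^]\<^bsub>P\<^esub> M \<otimes>\<^bsub>P\<^esub> f \<in> S"
    by (auto simp: P.localized_def)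
  moreover have "lowest_term (q * M + d) (e [^]\<^bsub>P\<^esub> M \<otimes>\<^bsub>P\<^esub> f) (c [^] M \<otimes> a)"
    unfolding e by (intro lowest_term_mult lowest_term_pow lowest_term_monom c low)
  ultimately have "monom P (c [^] M \<otimes> a) (q * M + d) \<in> S" by (rule lowest_term_mem)
  then have "e [^]\<^bsub>P\<^esub> M \<otimes>\<^bsub>P\<^esub> monom P a d \<in> S" using a c by (simp add: e monom_pow)
  then show ?thesis using a unfolding P.localized_def by auto
qed

lemma almost_integral_lowest_term:
  assumes e: "e = monom P c q" and c: "c \<in> carrier R"
    and f: "f \<in> P.almost_integral S e" and low: "lowest_term d f a"
  shows "monom P a d \<in> P.almost_integral S e"
proof -
  have a: "a \<in> carrier R" using low by (rule lowest_term_carrier)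
  from f obtain M :: nat where M: "\<And>N::nat. e [^]\<^bsub>P\<^esub> M \<otimes>\<^bsub>P\<^esub> f [^]\<^bsub>P\<^esub> N \<in> S"
    by (auto simp: P.almost_integral_def)
  have "e [^]\<^bsub>P\<^esub> M \<otimes>\<^bsub>P\<^esub> monom P a d [^]\<^bsub>P\<^esub> N \<in> S" for N :: nat
  proof -
    have "lowest_term (q * M + d * N) (e [^]\<^bsub>P\<^esub> M \<otimes>\<^bsub>P\<^esub> f [^]\<^bsub>P\<^esub> N) (c [^] M \<otimes> a [^] N)"
      unfolding e by (intro lowest_term_mult lowest_term_pow lowest_term_monom c low)
    with M have "monom P (c [^] M \<otimes> a [^] N) (q * M + d * N) \<in> S" by (rule lowest_term_mem)
    then show ?thesis using a c by (simp add: e monom_pow)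
  qed
  then show ?thesis using a unfolding P.almost_integral_def by auto
qed

lemma monom_add_pow:
  assumes "a \<in> carrier R"
  shows "monom P ([(n::nat)] \<cdot> a) d = [n] \<cdot>\<^bsub>P\<^esub> monom P a d"
  by (induct n) (use assms in auto)

lemma localized_cancel:
  assumes e: "e \<in> carrier P" and x: "x \<in> carrier P"
    and ex: "e [^]\<^bsub>P\<^esub> (n::nat) \<otimes>\<^bsub>P\<^esub> x \<in> P.localized S e"
  shows "x \<in> P.localized S e"
proof -
  from ex obtain M :: nat where "e [^]\<^bsub>P\<^esub> M \<otimes>\<^bsub>P\<^esub> (e [^]\<^bsub>P\<^esub> n \<otimes>\<^bsub>P\<^esub> x) \<in> S"
    by (auto simp: P.localized_def)
  then have "e [^]\<^bsub>P\<^esub> (M + n) \<otimes>\<^bsub>P\<^esub> x \<in> S"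
    using e x by (simp add: P.nat_pow_mult[symmetric] P.m_assoc)
  then show ?thesis using x unfolding P.localized_def by blast
qed

end

text \<open>Root closedness is required for homogeneous elements only; the aim of this locale is to remove
  that restriction.\<close>

locale root_closed_grading = graded_subalgebra +
  assumes J_root: "a \<in> carrier R \<Longrightarrow> n > 0 \<Longrightarrow> a [^] (n::nat) \<in> J (d * n) \<Longrightarrow> a \<in> J d"
begin

lemma monom_root:
  assumes a: "a \<in> carrier R" and n: "n > 0" and root: "monom P a d [^]\<^bsub>P\<^esub> (n::nat) \<in> S"
  shows "monom P a d \<in> S"
  using J_root[OF a n, of d] root a by (simp add: monom_pow monom_mem_iff)

lemma monom_lowest_mem:
  assumes low: "lowest_term d g c" and n: "n > 0" and root: "g [^]\<^bsub>P\<^esub> (n::nat) \<in> S"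
  shows "monom P c d \<in> S"
proof (rule monom_root[OF _ n])
  show c: "c \<in> carrier R" using low by (rule lowest_term_carrier)
  show "monom P c d [^]\<^bsub>P\<^esub> n \<in> S"
    using lowest_term_mem[OF root lowest_term_pow[OF low]] c by (simp add: monom_pow)
qed

text \<open>The components of \<open>g\<close> are found recursively from the coefficients of \<open>g\<^sup>p\<close>: if \<open>t\<close> is the part
  of \<open>g\<close> in degrees below \<open>j\<close>, the lowest term of \<open>g\<^sup>p - t\<^sup>p\<close> is \<open>p c\<^bsup>p - 1\<^esup>\<close> times the coefficient of \<open>t\<^sup>j\<close>
  in \<open>g\<close>. Inverting \<open>p\<close> and the lowest term of \<open>g\<close> therefore recovers that coefficient. This is
  the uniqueness of \<open>p\<close>-th roots of power series with invertible constant term.\<close>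

lemma root_localized:
  assumes low: "lowest_term d g c" and root: "g [^]\<^bsub>P\<^esub> (p::nat) \<in> S" and p: "p \<ge> 2"
  shows "g \<in> P.localized S ([p] \<cdot>\<^bsub>P\<^esub> monom P c d)"
proof -
  define e where "e = [p] \<cdot>\<^bsub>P\<^esub> monom P c d"
  have c: "c \<in> carrier R" using low by (rule lowest_term_carrier)
  have g: "g \<in> carrier P" using low by (simp add: lowest_term_def)
  have e_monom: "e = monom P ([p] \<cdot> c) d" using c by (simp add: e_def monom_add_pow)
  have b: "monom P c d \<in> S" using monom_lowest_mem[OF low _ root] p by simp
  have eS: "e \<in> S" unfolding e_def by (rule P.subring_add_pow[OF S_subring b])
  have ec: "e \<in> carrier P" using eS by (simp add: graded_sum_iff)
  let ?L = "P.localized S e"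
  have L: "subring ?L P" by (rule P.localized_subring[OF S_subring eS])
  note LE = subringE[OF L]
  have SL: "S \<subseteq> ?L" by (rule P.subset_localized[OF S_subring])
  have low_L: "monom P a i \<in> ?L" if "f \<in> ?L" "lowest_term i f a" for f i a
    using localized_lowest_term[OF e_monom _ that] c by simp
  obtain n where n: "p = Suc n" "n > 0" using p by (cases p) auto
  \<comment> \<open>the part of \<open>g\<close> below degree \<open>j\<close> is built up inside \<open>?L\<close>\<close>
  have trunc: "\<exists>t \<in> ?L. (\<forall>i<j. coeff P t i = coeff P g i) \<and> (\<forall>i\<ge>j. coeff P t i = \<zero>)" for j
  proof (induct j)
    case 0
    then show ?case using LE by (intro bexI[of _ "\<zero>\<^bsub>P\<^esub>"]) auto
  next
    case (Suc j)
    then obtain t where t: "t \<in> ?L" "\<And>i. i < j \<Longrightarrow> coeff P t i = coeff P g i"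
      "\<And>i. i \<ge> j \<Longrightarrow> coeff P t i = \<zero>" by auto
    have tc: "t \<in> carrier P" using t LE by auto
    define a where "a = coeff P g j"
    have a: "a \<in> carrier R" using g by (simp add: a_def)
    have "monom P a j \<in> ?L"
    proof (cases j d rule: linorder_cases)
      case less
      then have "a = \<zero>" using low by (simp add: a_def lowest_term_def)
      then show ?thesis using LE by simp
    next
      case equal
      then have "a = c" using low by (simp add: a_def lowest_term_def)
      then show ?thesis using subsetD[OF SL b] equal by simp
    next
      case greater
      have lowt: "lowest_term d t c"
        using low t(2) greater tc by (simp add: lowest_term_def)
      have "lowest_term j (g \<ominus>\<^bsub>P\<^esub> t) a"
        using g tc t(2,3) a by (simp add: lowest_term_def a_minus_def R.r_neg R.minus_zero a_def)
      from lowest_term_pow_diff[OF low lowt this, of n]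
      have "lowest_term (d * n + j) (g [^]\<^bsub>P\<^esub> p \<ominus>\<^bsub>P\<^esub> t [^]\<^bsub>P\<^esub> p) ([p] \<cdot> (c [^] n \<otimes> a))"
        unfolding n .
      moreover have "g [^]\<^bsub>P\<^esub> p \<ominus>\<^bsub>P\<^esub> t [^]\<^bsub>P\<^esub> p \<in> ?L"
        by (intro P.subring_minus[OF L] P.subring_nat_pow[OF L] subsetD[OF SL root] t)
      ultimately have "monom P ([p] \<cdot> (c [^] n \<otimes> a)) (d * n + j) \<in> ?L" using low_L by blast
      \<comment> \<open>with \<open>n = p - 1\<close>, the missing factor \<open>p\<^bsup>n - 1\<^esup>\<close> completes \<open>p c\<^sup>n\<close> to \<open>(p c)\<^sup>n\<close>, a power of \<open>e\<close>\<close>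
      then have "[(p ^ (n - 1))] \<cdot>\<^bsub>P\<^esub> monom P ([p] \<cdot> (c [^] n \<otimes> a)) (d * n + j) \<in> ?L"
        by (rule P.subring_add_pow[OF L])
      moreover have "[(p ^ (n - 1))] \<cdot>\<^bsub>P\<^esub> monom P ([p] \<cdot> (c [^] n \<otimes> a)) (d * n + j)
          = e [^]\<^bsub>P\<^esub> n \<otimes>\<^bsub>P\<^esub> monom P a j"
      proof -
        have "p * p ^ (n - 1) = p ^ n" using n(2) by (simp add: power_eq_if)
        then have "([p] \<cdot> c) [^] n \<otimes> a = [(p ^ (n - 1))] \<cdot> ([p] \<cdot> (c [^] n \<otimes> a))"
          using c a by (simp only: R.add_pow_nat_pow R.add.nat_pow_pow R.add_pow_ldistr R.nat_pow_closed R.m_closed)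
        then have "monom P (([p] \<cdot> c) [^] n \<otimes> a) (d * n + j)
            = [(p ^ (n - 1))] \<cdot>\<^bsub>P\<^esub> monom P ([p] \<cdot> (c [^] n \<otimes> a)) (d * n + j)"
          using a c by (simp only: monom_add_pow R.add.nat_pow_closed R.nat_pow_closed R.m_closed)
        then show ?thesis using a c by (simp add: e_monom monom_pow)
      qed
      ultimately have "e [^]\<^bsub>P\<^esub> n \<otimes>\<^bsub>P\<^esub> monom P a j \<in> ?L" by simp
      then show ?thesis by (rule localized_cancel[OF ec monom_closed[OF a]])
    qed
    then have "t \<oplus>\<^bsub>P\<^esub> monom P a j \<in> ?L" by (rule LE(7)[OF t(1)])
    moreover have "coeff P (t \<oplus>\<^bsub>P\<^esub> monom P a j) i = (if i < Suc j then coeff P g i else \<zero>)" for i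
      using tc t(2)[of i] t(3)[of i] a g by (cases i j rule: linorder_cases) (auto simp: a_def)
    ultimately show ?case
      by (intro bexI[of _ "t \<oplus>\<^bsub>P\<^esub> monom P a j"]) auto
  qed
  have "monom P (coeff P g j) j \<in> ?L" for j
  proof -
    obtain t where t: "t \<in> ?L" "coeff P t j = coeff P g j" using trunc[of "Suc j"] by auto
    have "monom P (coeff P t j) j \<in> ?L" by (rule components_mem[OF L low_L t(1)])
    then show ?thesis by (simp only: t(2))
  qed
  then show ?thesis using mem_if_components_mem[OF L g] by (simp add: e_def)
qed

text \<open>The element \<open>e = p c t\<^sup>d\<close> itself is a denominator: \<open>g\<^sup>i\<close> is almost integral,
  hence so is each of its components \<open>w\<close>, and then a large power of the homogeneous element \<open>e w\<close>
  contains enough factors \<open>e\<close> to absorb the common denominator of the powers of \<open>w\<close>. Root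
  closedness in the homogeneous case gives \<open>e w \<in> S\<close>.\<close>

lemma root_conductor:
  assumes low: "lowest_term d g c" and root: "g [^]\<^bsub>P\<^esub> (p::nat) \<in> S" and p: "p \<ge> 2"
  shows "([p] \<cdot>\<^bsub>P\<^esub> monom P c d) \<otimes>\<^bsub>P\<^esub> g [^]\<^bsub>P\<^esub> (i::nat) \<in> S"
proof -
  define e where "e = [p] \<cdot>\<^bsub>P\<^esub> monom P c d"
  have c: "c \<in> carrier R" using low by (rule lowest_term_carrier)
  have g: "g \<in> carrier P" using low by (simp add: lowest_term_def)
  have e_monom: "e = monom P ([p] \<cdot> c) d" using c by (simp add: e_def monom_add_pow)
  have b: "monom P c d \<in> S" using monom_lowest_mem[OF low _ root] p by simp
  have eS: "e \<in> S" unfolding e_def by (rule P.subring_add_pow[OF S_subring b])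
  have ec: "e \<in> carrier P" using eS by (simp add: graded_sum_iff)
  let ?T = "P.almost_integral S e"
  have T: "subring ?T P" by (rule P.almost_integral_subring[OF S_subring eS])
  have low_T: "monom P a i \<in> ?T" if "f \<in> ?T" "lowest_term i f a" for f i a
    using almost_integral_lowest_term[OF e_monom _ that] c by simp
  have "g \<in> ?T"
    using P.localized_root_almost_integral[OF S_subring eS _ root] root_localized[OF low root p] p
    by (simp add: e_def)
  then have gi: "g [^]\<^bsub>P\<^esub> i \<in> ?T" by (rule P.subring_nat_pow[OF T])
  have comp: "e \<otimes>\<^bsub>P\<^esub> monom P (coeff P (g [^]\<^bsub>P\<^esub> i) j) j \<in> S" for j
  proof -
    define a where "a = coeff P (g [^]\<^bsub>P\<^esub> i) j"
    define w where "w = monom P a j"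
    have a: "a \<in> carrier R" using g by (simp add: a_def)
    have w: "w \<in> carrier P" using a by (simp add: w_def)
    have "w \<in> ?T" unfolding w_def a_def by (rule components_mem[OF T low_T gi])
    then obtain M :: nat where M: "\<And>N::nat. e [^]\<^bsub>P\<^esub> M \<otimes>\<^bsub>P\<^esub> w [^]\<^bsub>P\<^esub> N \<in> S"
      by (auto simp: P.almost_integral_def)
    have "(e \<otimes>\<^bsub>P\<^esub> w) [^]\<^bsub>P\<^esub> Suc M = e \<otimes>\<^bsub>P\<^esub> (e [^]\<^bsub>P\<^esub> M \<otimes>\<^bsub>P\<^esub> w [^]\<^bsub>P\<^esub> Suc M)"
      using ec w by (simp add: P.nat_pow_distrib P.m_ac)
    also have "\<dots> \<in> S" using M eS subringE(6)[OF S_subring] by blast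
    finally have "monom P ([p] \<cdot> c \<otimes> a) (d + j) [^]\<^bsub>P\<^esub> Suc M \<in> S"
      using a c by (simp add: e_monom w_def)
    then have "monom P ([p] \<cdot> c \<otimes> a) (d + j) \<in> S"
      using a c by (intro monom_root[of _ "Suc M"]) auto
    then show ?thesis using a c by (simp add: e_monom flip: a_def)
  qed
  have "e \<otimes>\<^bsub>P\<^esub> g [^]\<^bsub>P\<^esub> i
      = e \<otimes>\<^bsub>P\<^esub> (\<Oplus>\<^bsub>P\<^esub> j \<in> {..deg R (g [^]\<^bsub>P\<^esub> i)}. monom P (coeff P (g [^]\<^bsub>P\<^esub> i) j) j)"
    using g by (simp add: up_repr)
  also have "\<dots> = (\<Oplus>\<^bsub>P\<^esub> j \<in> {..deg R (g [^]\<^bsub>P\<^esub> i)}. e \<otimes>\<^bsub>P\<^esub> monom P (coeff P (g [^]\<^bsub>P\<^esub> i) j) j)"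
    using ec g by (intro P.finsum_rdistr) auto
  also have "\<dots> \<in> S" by (rule P.subring_finsum[OF S_subring comp])
  finally show ?thesis by (simp add: e_def)
qed

text \<open>Removing the lowest term \<open>b\<close> from a \<open>p\<close>-th root leaves a \<open>p\<close>-th root: the mixed terms in the
  expansion of \<open>(g - b)\<^sup>p\<close> contain the factor \<open>p b\<close>, which multiplies every power of \<open>g\<close> into \<open>S\<close>.\<close>

lemma prime_root_peel:
  assumes low: "lowest_term d g c" and root: "g [^]\<^bsub>P\<^esub> (p::nat) \<in> S" and p: "prime p"
  shows "(g \<ominus>\<^bsub>P\<^esub> monom P c d) [^]\<^bsub>P\<^esub> p \<in> S"
proof -
  define b where "b = monom P c d"
  have g: "g \<in> carrier P" using low by (simp add: lowest_term_def)
  have p2: "p \<ge> 2" using p by (rule prime_ge_2_nat)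
  have bS: "b \<in> S" unfolding b_def using monom_lowest_mem[OF low _ root] p2 by simp
  note SE = subringE[OF S_subring]
  have b: "b \<in> carrier P" using bS SE by blast
  have nb: "\<ominus>\<^bsub>P\<^esub> b \<in> S" using bS SE by blast
  have "[p] \<cdot>\<^bsub>P\<^esub> (g [^]\<^bsub>P\<^esub> Suc i \<otimes>\<^bsub>P\<^esub> (\<ominus>\<^bsub>P\<^esub> b) [^]\<^bsub>P\<^esub> Suc j) \<in> S" for i j :: nat
  proof -
    define x where "x = g [^]\<^bsub>P\<^esub> Suc i"
    define y where "y = (\<ominus>\<^bsub>P\<^esub> b) [^]\<^bsub>P\<^esub> j"
    have yS: "y \<in> S" unfolding y_def by (rule P.subring_nat_pow[OF S_subring nb])
    have xy: "x \<in> carrier P" "y \<in> carrier P" using g yS SE by (auto simp: x_def)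
    have "x \<otimes>\<^bsub>P\<^esub> (y \<otimes>\<^bsub>P\<^esub> (\<ominus>\<^bsub>P\<^esub> b)) = (b \<otimes>\<^bsub>P\<^esub> x) \<otimes>\<^bsub>P\<^esub> (\<ominus>\<^bsub>P\<^esub> y)"
      using xy b by algebra
    then have "[p] \<cdot>\<^bsub>P\<^esub> (x \<otimes>\<^bsub>P\<^esub> (y \<otimes>\<^bsub>P\<^esub> (\<ominus>\<^bsub>P\<^esub> b))) = ([p] \<cdot>\<^bsub>P\<^esub> b \<otimes>\<^bsub>P\<^esub> x) \<otimes>\<^bsub>P\<^esub> (\<ominus>\<^bsub>P\<^esub> y)"
      using xy b by (simp only: P.add_pow_ldistr P.m_closed P.a_inv_closed)
    moreover have "[p] \<cdot>\<^bsub>P\<^esub> b \<otimes>\<^bsub>P\<^esub> x \<in> S"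
      unfolding b_def x_def by (rule root_conductor[OF low root p2])
    ultimately have "[p] \<cdot>\<^bsub>P\<^esub> (x \<otimes>\<^bsub>P\<^esub> (y \<otimes>\<^bsub>P\<^esub> (\<ominus>\<^bsub>P\<^esub> b))) \<in> S" using SE(6)[OF _ SE(5)[OF yS]] by simp
    then show ?thesis by (simp add: x_def y_def)
  qed
  then have "(g \<oplus>\<^bsub>P\<^esub> (\<ominus>\<^bsub>P\<^esub> b)) [^]\<^bsub>P\<^esub> p \<in> S"
    using g b root P.subring_nat_pow[OF S_subring nb] by (intro P.subring_prime_pow_add[OF S_subring p]) auto
  then show ?thesis by (simp add: a_minus_def b_def)
qed

text \<open>Peeling off lowest terms exhibits the coefficients of \<open>f\<close> one after another as coefficients of an
  element of \<open>S\<close>, namely of the part \<open>f - g\<close> that has already been removed.\<close>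

lemma prime_root_mem:
  assumes f: "f \<in> carrier P" and root: "f [^]\<^bsub>P\<^esub> (p::nat) \<in> S" and p: "prime p"
  shows "f \<in> S"
proof -
  note SE = subringE[OF S_subring]
  have "\<exists>g \<in> carrier P. g [^]\<^bsub>P\<^esub> p \<in> S \<and> f \<ominus>\<^bsub>P\<^esub> g \<in> S \<and> (\<forall>i<d. coeff P g i = \<zero>)" for d
  proof (induct d)
    case 0
    have "f \<ominus>\<^bsub>P\<^esub> f \<in> S" using f SE(2) by (simp add: a_minus_def P.r_neg)
    then show ?case using f root by blast
  next
    case (Suc d)
    then obtain g where g: "g \<in> carrier P" "g [^]\<^bsub>P\<^esub> p \<in> S" "f \<ominus>\<^bsub>P\<^esub> g \<in> S"
      "\<And>i. i < d \<Longrightarrow> coeff P g i = \<zero>" by auto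
    define b where "b = monom P (coeff P g d) d"
    have low: "lowest_term d g (coeff P g d)" using g by (simp add: lowest_term_def)
    have bS: "b \<in> S" unfolding b_def using monom_lowest_mem[OF low _ g(2)] prime_gt_0_nat[OF p] by simp
    have b: "b \<in> carrier P" using bS SE by blast
    have "f \<ominus>\<^bsub>P\<^esub> (g \<ominus>\<^bsub>P\<^esub> b) = (f \<ominus>\<^bsub>P\<^esub> g) \<oplus>\<^bsub>P\<^esub> b" using f g b by algebra
    then have "f \<ominus>\<^bsub>P\<^esub> (g \<ominus>\<^bsub>P\<^esub> b) \<in> S" using SE(7)[OF g(3) bS] by simp
    moreover have "(g \<ominus>\<^bsub>P\<^esub> b) [^]\<^bsub>P\<^esub> p \<in> S" unfolding b_def by (rule prime_root_peel[OF low g(2) p])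
    moreover have "coeff P (g \<ominus>\<^bsub>P\<^esub> b) i = \<zero>" if "i < Suc d" for i
      using that g(1) g(4)[of i] by (cases "i = d") (auto simp: b_def a_minus_def R.r_neg R.minus_zero)
    ultimately show ?case using g(1) b by (intro bexI[of _ "g \<ominus>\<^bsub>P\<^esub> b"]) auto
  qed
  note peel = this
  have "coeff P f n \<in> J n" for n
  proof -
    obtain g where g: "g \<in> carrier P" "f \<ominus>\<^bsub>P\<^esub> g \<in> S" "coeff P g n = \<zero>"
      using peel[of "Suc n"] by auto
    then have "coeff P (f \<ominus>\<^bsub>P\<^esub> g) n = coeff P f n" using f by (simp add: a_minus_def R.minus_zero)
    then show ?thesis using g by (metis graded_sum_iff)
  qed
  then show ?thesis using f by (simp add: graded_sum_iff)
qed

text \<open>Peeling needs a prime exponent, and a general exponent is a product of primes.\<close>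

theorem graded_sum_root_closed: "root_closed P S"
proof -
  have "f \<in> S" if "f \<in> carrier P" "n \<ge> 1" "f [^]\<^bsub>P\<^esub> n \<in> S" for f and n :: nat
    using that
  proof (induct n arbitrary: f rule: less_induct)
    case (less n)
    show ?case
    proof (cases "n = 1")
      case True
      then show ?thesis using less.prems by simp
    next
      case False
      then obtain p where p: "prime p" "p dvd n" using prime_factor_nat by blast
      then obtain k where k: "n = p * k" by blast
      then have k1: "k \<ge> 1" using less.prems by (cases k) auto
      have "k < n" using k k1 prime_gt_1_nat[OF p(1)] by simp
      have "(f [^]\<^bsub>P\<^esub> k) [^]\<^bsub>P\<^esub> p \<in> S"
        using less.prems k by (simp add: P.nat_pow_pow mult.commute)
      then have "f [^]\<^bsub>P\<^esub> k \<in> S" using prime_root_mem[OF _ _ p(1)] less.prems by simp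
      then show ?thesis using less.hyps[OF \<open>k < n\<close>] less.prems k1 by simp
    qed
  qed
  then show ?thesis unfolding root_closed_def by blast
qed

end

section \<open>The sharp and natural closures of ideals\<close>

context cring
begin

lemma ideal_pow_laws:
  assumes J: "ideal J R"
  shows ideal_pow_ideal: "ideal (ideal_pow R J n) R"
    and ideal_pow_add: "ideal_pow R J m \<cdot> ideal_pow R J n = ideal_pow R J (m + n)"
    and ideal_pow_pow: "ideal_pow R (ideal_pow R J m) n = ideal_pow R J (m * n)"
proof -
  interpret M: comm_monoid "ideals_set R" by (rule ideals_set_is_comm_monoid)
  have J': "J \<in> carrier (ideals_set R)" using J by (simp add: ideals_set_def)
  show "ideal (ideal_pow R J n) R"
    using M.nat_pow_closed[OF J'] by (simp add: ideal_pow_def ideals_set_def)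
  show "ideal_pow R J m \<cdot> ideal_pow R J n = ideal_pow R J (m + n)"
    using M.nat_pow_mult[OF J'] by (simp add: ideal_pow_def ideals_set_def)
  show "ideal_pow R (ideal_pow R J m) n = ideal_pow R J (m * n)"
    using M.nat_pow_pow[OF J'] by (simp add: ideal_pow_def)
qed

lemma ideal_pow_one: "ideal J R \<Longrightarrow> ideal_pow R J 1 = J"
  by (simp add: ideal_pow_simps ideal_prod_one ideal_prod_commute oneideal)

lemma ideal_pow_prod:
  assumes "ideal J R" "ideal K R"
  shows "ideal_pow R (J \<cdot> K) n = ideal_pow R J n \<cdot> ideal_pow R K n"
proof -
  interpret M: comm_monoid "ideals_set R" by (rule ideals_set_is_comm_monoid)
  have "J \<in> carrier (ideals_set R)" "K \<in> carrier (ideals_set R)"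
    using assms by (simp_all add: ideals_set_def)
  from M.nat_pow_distrib[OF this] show ?thesis by (simp add: ideal_pow_def ideals_set_def)
qed

lemma ideal_prod_mono:
  assumes "J \<subseteq> J'" "K \<subseteq> K'" shows "J \<cdot> K \<subseteq> J' \<cdot> K'"
proof
  fix x assume "x \<in> J \<cdot> K"
  then show "x \<in> J' \<cdot> K'"
    by induct (use assms in \<open>auto intro: ideal_prod.intros\<close>)
qed

lemma ideal_pow_mono: "J \<subseteq> K \<Longrightarrow> ideal_pow R J n \<subseteq> ideal_pow R K n"
  by (induct n) (simp_all add: ideal_pow_simps ideal_prod_mono)

lemma pow_mem_ideal_pow:
  assumes "ideal J R" "x \<in> J" shows "x [^] n \<in> ideal_pow R J n"
  by (induct n) (use assms in \<open>auto simp: ideal_pow_simps intro: ideal_prod.prod\<close>)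

lemma sharp_ideal: "ideal (ideal_sharp R J) R"
  unfolding ideal_sharp_def by (rule genideal_ideal) auto

lemma sharp_root:
  assumes "x \<in> carrier R" "n > 0" "x [^] (n::nat) \<in> ideal_pow R J n"
  shows "x \<in> ideal_sharp R J"
proof -
  have "x \<in> {x \<in> carrier R. \<exists>n :: nat. n \<ge> 1 \<and> x [^] n \<in> ideal_pow R J n}"
    using assms by (auto intro!: exI[of _ n])
  then show ?thesis unfolding ideal_sharp_def by (rule subsetD[OF genideal_self, rotated]) auto
qed

lemma sharp_subset:
  assumes "ideal K R"
    and "\<And>x n. x \<in> carrier R \<Longrightarrow> n > 0 \<Longrightarrow> x [^] (n::nat) \<in> ideal_pow R J n \<Longrightarrow> x \<in> K"
  shows "ideal_sharp R J \<subseteq> K"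
  unfolding ideal_sharp_def by (rule genideal_minimal[OF assms(1)]) (auto simp: Suc_le_eq intro: assms(2))

lemma subset_sharp:
  assumes J: "ideal J R" shows "J \<subseteq> ideal_sharp R J"
proof
  fix x assume x: "x \<in> J"
  then have "x \<in> carrier R" using ideal.Icarr[OF J] by blast
  then show "x \<in> ideal_sharp R J"
    by (rule sharp_root[of _ 1]) (use x ideal_pow_one[OF J] \<open>x \<in> carrier R\<close> in simp_all)
qed

lemma sharp_mono:
  assumes "J \<subseteq> K" shows "ideal_sharp R J \<subseteq> ideal_sharp R K"
  by (rule sharp_subset[OF sharp_ideal]) (meson sharp_root ideal_pow_mono[OF assms] subsetD)

text \<open>Used to check a condition that is linear in one argument on ideal generators only.\<close>

lemma colon_ideal:
  assumes K: "ideal K R" and y: "y \<in> carrier R"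
  shows "ideal {x \<in> carrier R. x \<otimes> y \<in> K} R"
proof -
  interpret K: ideal K R by (rule K)
  show ?thesis
  proof (rule idealI[OF ring_axioms])
    show "subgroup {x \<in> carrier R. x \<otimes> y \<in> K} (add_monoid R)"
      by (rule add.subgroupI) (use y in \<open>auto simp: l_distr l_minus simp flip: a_inv_def intro!: exI[of _ \<zero>]\<close>)
  next
    fix a x assume "a \<in> {x \<in> carrier R. x \<otimes> y \<in> K}" and x: "x \<in> carrier R"
    then have a: "a \<in> carrier R" "a \<otimes> y \<in> K" by auto
    have "x \<otimes> (a \<otimes> y) \<in> K" using a x by (simp add: K.I_l_closed)
    then show "x \<otimes> a \<in> {x \<in> carrier R. x \<otimes> y \<in> K}" "a \<otimes> x \<in> {x \<in> carrier R. x \<otimes> y \<in> K}"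
      using a x y by (simp_all add: m_ac)
  qed
qed

text \<open>On generators, \<open>u\<^sup>m \<in> J\<^sup>m\<close> and \<open>v\<^sup>n \<in> K\<^sup>n\<close> give \<open>(u v)\<^bsup>m n\<^esup> \<in> (J K)\<^bsup>m n\<^esup>\<close>. The passage to the
  generated ideals is done in one argument at a time.\<close>

lemma sharp_mult:
  assumes J: "ideal J R" and K: "ideal K R"
    and x: "x \<in> ideal_sharp R J" and y: "y \<in> ideal_sharp R K"
  shows "x \<otimes> y \<in> ideal_sharp R (J \<cdot> K)"
proof -
  let ?JK = "ideal_sharp R (J \<cdot> K)"
  have gen: "u \<otimes> v \<in> ?JK"
    if u: "u \<in> carrier R" "m > 0" "u [^] m \<in> ideal_pow R J m"
      and v: "v \<in> carrier R" "n > 0" "v [^] n \<in> ideal_pow R K n" for u v and m n :: nat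
  proof (rule sharp_root)
    have "(u [^] m) [^] n \<in> ideal_pow R J (m * n)"
      using pow_mem_ideal_pow[OF ideal_pow_ideal[OF J] u(3)] by (simp add: ideal_pow_pow[OF J])
    moreover have "(v [^] n) [^] m \<in> ideal_pow R K (n * m)"
      using pow_mem_ideal_pow[OF ideal_pow_ideal[OF K] v(3)] by (simp add: ideal_pow_pow[OF K])
    ultimately have "u [^] (m * n) \<otimes> v [^] (m * n) \<in> ideal_pow R J (m * n) \<cdot> ideal_pow R K (m * n)"
      using u(1) v(1) by (intro ideal_prod.prod) (simp_all add: nat_pow_pow mult.commute)
    then show "(u \<otimes> v) [^] (m * n) \<in> ideal_pow R (J \<cdot> K) (m * n)"
      using u v by (simp add: ideal_pow_prod[OF J K] nat_pow_distrib)
  qed (use u v in auto)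
  have carr: "x \<in> carrier R" "y \<in> carrier R"
    using x y ideal.Icarr[OF sharp_ideal] by blast+
  have "u \<otimes> y \<in> ?JK" if u: "u \<in> carrier R" "m > 0" "u [^] m \<in> ideal_pow R J m" for u and m :: nat
  proof -
    have "ideal_sharp R K \<subseteq> {v \<in> carrier R. v \<otimes> u \<in> ?JK}"
      using u by (intro sharp_subset[OF colon_ideal[OF sharp_ideal u(1)]]) (simp add: m_comm[of _ u] gen)
    then show ?thesis using y carr u by (auto simp: m_comm)
  qed
  then have "ideal_sharp R J \<subseteq> {u \<in> carrier R. u \<otimes> y \<in> ?JK}"
    by (intro sharp_subset[OF colon_ideal[OF sharp_ideal carr(2)]]) auto
  then show ?thesis using x by auto
qed

lemma iterated_sharp_ideal: "ideal J R \<Longrightarrow> ideal ((ideal_sharp R ^^ l) J) R"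
  by (cases l) (simp_all add: sharp_ideal)

lemma iterated_sharp_mono:
  assumes "ideal J R" "l \<le> m"
  shows "(ideal_sharp R ^^ l) J \<subseteq> (ideal_sharp R ^^ m) J"
  using assms(2)
proof (induct rule: dec_induct)
  case (step k)
  then show ?case using subset_sharp[OF iterated_sharp_ideal[OF assms(1), of k]] by simp
qed simp

lemma iterated_sharp_mult:
  assumes J: "ideal J R" and K: "ideal K R"
    and "x \<in> (ideal_sharp R ^^ l) J" "y \<in> (ideal_sharp R ^^ l) K"
  shows "x \<otimes> y \<in> (ideal_sharp R ^^ l) (J \<cdot> K)"
  using assms(3,4)
proof (induct l arbitrary: x y)
  case 0
  then show ?case by (simp add: ideal_prod.prod)
next
  case (Suc l)
  let ?J = "(ideal_sharp R ^^ l) J" and ?K = "(ideal_sharp R ^^ l) K"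
    and ?JK = "(ideal_sharp R ^^ l) (J \<cdot> K)"
  have "?J \<cdot> ?K \<subseteq> ?JK"
  proof
    fix z assume "z \<in> ?J \<cdot> ?K"
    then show "z \<in> ?JK"
    proof induct
      case (sum s t)
      then show ?case
        using iterated_sharp_ideal[OF ideal_prod_is_ideal[OF J K]]
        by (simp add: additive_subgroup.a_closed ideal.axioms(1))
    qed (rule Suc.hyps)
  qed
  moreover have "x \<otimes> y \<in> ideal_sharp R (?J \<cdot> ?K)"
    using Suc.prems by (intro sharp_mult iterated_sharp_ideal J K) simp_all
  ultimately show ?case using sharp_mono by auto
qed

lemma iterated_sharp_pow:
  assumes J: "ideal J R" and x: "x \<in> (ideal_sharp R ^^ l) J"
  shows "x [^] n \<in> (ideal_sharp R ^^ l) (ideal_pow R J n)"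
proof (induct n)
  case 0
  show ?case
    using iterated_sharp_mono[OF oneideal, of 0 l] by (auto simp: ideal_pow_simps)
next
  case (Suc n)
  then show ?case
    using iterated_sharp_mult[OF ideal_pow_ideal[OF J] J _ x] by (simp add: ideal_pow_simps)
qed

text \<open>The iterates of the sharp operation increase, so the union may start at \<open>l = 0\<close> as well as at
  \<open>l = 1\<close>.\<close>

lemma natural_iff:
  assumes J: "ideal J R"
  shows "x \<in> ideal_natural R J \<longleftrightarrow> x \<in> carrier R \<and>
    (\<exists>n > 0. \<exists>l. x [^] (n::nat) \<in> (ideal_sharp R ^^ l) (ideal_pow R J n))"
proof -
  have "y \<in> ideal_box_sharp R K \<longleftrightarrow> (\<exists>l. y \<in> (ideal_sharp R ^^ l) K)" if K: "ideal K R" for y K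
  proof
    assume "\<exists>l. y \<in> (ideal_sharp R ^^ l) K"
    then obtain l where "y \<in> (ideal_sharp R ^^ l) K" by blast
    then have "y \<in> (ideal_sharp R ^^ Suc l) K" using iterated_sharp_mono[OF K, of l "Suc l"] by auto
    then show "y \<in> ideal_box_sharp R K" unfolding ideal_box_sharp_def by fastforce
  qed (auto simp: ideal_box_sharp_def)
  from this[OF ideal_pow_ideal[OF J]] show ?thesis
    unfolding ideal_natural_def by (simp add: Suc_le_eq)
qed

text \<open>Two elements can be compared in one power of the ideal and at one level of the iteration: the
  exponents are multiplied and the larger level is taken.\<close>

lemma natural_common_exponent:
  assumes J: "ideal J R" and K: "ideal K R"
    and x: "x \<in> ideal_natural R J" and y: "y \<in> ideal_natural R K"
  obtains n l where "n > 0" "x [^] (n::nat) \<in> (ideal_sharp R ^^ l) (ideal_pow R J n)"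
    "y [^] n \<in> (ideal_sharp R ^^ l) (ideal_pow R K n)"
proof -
  have carr: "x \<in> carrier R" "y \<in> carrier R" using x y natural_iff J K by blast+
  obtain m k where m: "m > 0" "x [^] (m::nat) \<in> (ideal_sharp R ^^ k) (ideal_pow R J m)"
    using x natural_iff[OF J] by blast
  obtain n l where n: "n > 0" "y [^] (n::nat) \<in> (ideal_sharp R ^^ l) (ideal_pow R K n)"
    using y natural_iff[OF K] by blast
  show ?thesis
  proof (rule that)
    show "m * n > 0" using m n by simp
    have "x [^] (m * n) \<in> (ideal_sharp R ^^ k) (ideal_pow R J (m * n))"
      using iterated_sharp_pow[OF ideal_pow_ideal[OF J] m(2), of n] carr
      by (simp add: nat_pow_pow ideal_pow_pow[OF J])
    then show "x [^] (m * n) \<in> (ideal_sharp R ^^ max k l) (ideal_pow R J (m * n))"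
      using iterated_sharp_mono[OF ideal_pow_ideal[OF J], of k "max k l"] by auto
    have "y [^] (m * n) \<in> (ideal_sharp R ^^ l) (ideal_pow R K (m * n))"
      using iterated_sharp_pow[OF ideal_pow_ideal[OF K] n(2), of m] carr
      by (simp add: nat_pow_pow ideal_pow_pow[OF K] mult.commute)
    then show "y [^] (m * n) \<in> (ideal_sharp R ^^ max k l) (ideal_pow R K (m * n))"
      using iterated_sharp_mono[OF ideal_pow_ideal[OF K], of l "max k l"] by auto
  qed
qed

lemma subset_natural:
  assumes J: "ideal J R" shows "J \<subseteq> ideal_natural R J"
proof
  fix x assume x: "x \<in> J"
  then have xc: "x \<in> carrier R" using ideal.Icarr[OF J] by blast
  then have "x [^] (1::nat) \<in> (ideal_sharp R ^^ 0) (ideal_pow R J 1)"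
    using x ideal_pow_one[OF J] by simp
  then show "x \<in> ideal_natural R J" unfolding natural_iff[OF J] using xc zero_less_one by blast
qed

lemma natural_mult:
  assumes J: "ideal J R" and K: "ideal K R"
    and x: "x \<in> ideal_natural R J" and y: "y \<in> ideal_natural R K"
  shows "x \<otimes> y \<in> ideal_natural R (J \<cdot> K)"
proof -
  have carr: "x \<in> carrier R" "y \<in> carrier R" using x y natural_iff J K by blast+
  obtain n l where n: "n > 0" "x [^] (n::nat) \<in> (ideal_sharp R ^^ l) (ideal_pow R J n)"
    "y [^] n \<in> (ideal_sharp R ^^ l) (ideal_pow R K n)"
    using natural_common_exponent[OF assms] .
  have "(x \<otimes> y) [^] n \<in> (ideal_sharp R ^^ l) (ideal_pow R (J \<cdot> K) n)"
    using iterated_sharp_mult[OF ideal_pow_ideal[OF J] ideal_pow_ideal[OF K] n(2,3)] carr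
    by (simp add: nat_pow_distrib ideal_pow_prod[OF J K])
  then show ?thesis unfolding natural_iff[OF ideal_prod_is_ideal[OF J K]] using carr n(1) by blast
qed

text \<open>Let \<open>x\<^sup>n\<close> and \<open>y\<^sup>n\<close> lie in \<open>K\<close>, an iterated sharp of \<open>J\<^sup>n\<close>. The monomials \<open>z = x\<^sup>i y\<^sup>j\<close> with
  \<open>i + j = n\<close> satisfy \<open>z\<^sup>n = (x\<^sup>n)\<^sup>i (y\<^sup>n)\<^sup>j \<in> K\<^sup>n\<close>, so they lie in the next iterate, and with them
  \<open>(x + y)\<^sup>n\<close>.\<close>

lemma natural_add:
  assumes J: "ideal J R"
    and x: "x \<in> ideal_natural R J" and y: "y \<in> ideal_natural R J"
  shows "x \<oplus> y \<in> ideal_natural R J"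
proof -
  have carr: "x \<in> carrier R" "y \<in> carrier R" using x y natural_iff J by blast+
  obtain n l where n: "n > 0" "x [^] (n::nat) \<in> (ideal_sharp R ^^ l) (ideal_pow R J n)"
    "y [^] n \<in> (ideal_sharp R ^^ l) (ideal_pow R J n)"
    using natural_common_exponent[OF J J x y] .
  define K where "K = (ideal_sharp R ^^ l) (ideal_pow R J n)"
  have K: "ideal K R" unfolding K_def by (intro iterated_sharp_ideal ideal_pow_ideal J)
  have "(x \<oplus> y) [^] n \<in> ideal_sharp R K"
  proof (rule pow_add_mem[OF _ carr])
    fix i j assume ij: "i + j = n"
    show "x [^] i \<otimes> y [^] j \<in> ideal_sharp R K"
    proof (rule sharp_root[OF _ n(1)])
      have "(x [^] n) [^] i \<otimes> (y [^] n) [^] j \<in> ideal_pow R K i \<cdot> ideal_pow R K j"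
        by (intro ideal_prod.prod pow_mem_ideal_pow K n(2,3)[folded K_def])
      then show "(x [^] i \<otimes> y [^] j) [^] n \<in> ideal_pow R K n"
        using carr ij by (simp add: ideal_pow_add[OF K] nat_pow_distrib nat_pow_pow mult.commute)
    qed (use carr in simp)
  qed (rule additive_subgroup.a_closed[OF ideal.axioms(1)[OF sharp_ideal]])
  then have "(x \<oplus> y) [^] n \<in> (ideal_sharp R ^^ Suc l) (ideal_pow R J n)" by (simp add: K_def)
  then show ?thesis unfolding natural_iff[OF J] using carr n(1) by blast
qed

lemma natural_additive_subgroup:
  assumes J: "ideal J R" shows "additive_subgroup (ideal_natural R J) R"
proof -
  have "ideal_natural R J \<subseteq> carrier R" using natural_iff[OF J] by blast
  moreover have "\<zero> \<in> ideal_natural R J"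
    using subset_natural[OF J] additive_subgroup.zero_closed[OF ideal.axioms(1)[OF J]] by blast
  moreover have "\<ominus> x \<in> ideal_natural R J" if x: "x \<in> ideal_natural R J" for x
  proof -
    have xc: "x \<in> carrier R" using x natural_iff[OF J] by blast
    have "\<ominus> \<one> \<in> ideal_natural R (carrier R)" using subset_natural[OF oneideal] by auto
    from natural_mult[OF J oneideal x this] show ?thesis
      using xc by (simp add: ideal_prod_one[OF J] r_minus)
  qed
  ultimately show ?thesis
    unfolding additive_subgroup_def
    by (intro add.subgroupI) (use natural_add[OF J] in \<open>auto simp flip: a_inv_def\<close>)
qed

text \<open>As \<open>(J\<^sup>k)\<^sup>n = J\<^bsup>k n\<^esup>\<close>, the root condition with exponent \<open>n\<close> on \<open>x\<^sup>k\<close> relative to \<open>J\<^sup>k\<close> is the one with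
  exponent \<open>k n\<close> on \<open>x\<close> relative to \<open>J\<close>.\<close>

lemma natural_root:
  assumes J: "ideal J R" and x: "x \<in> carrier R" and k: "k > 0"
    and root: "x [^] (k::nat) \<in> ideal_natural R (ideal_pow R J k)"
  shows "x \<in> ideal_natural R J"
proof -
  from root obtain n l where n: "n > 0"
    "(x [^] k) [^] (n::nat) \<in> (ideal_sharp R ^^ l) (ideal_pow R (ideal_pow R J k) n)"
    unfolding natural_iff[OF ideal_pow_ideal[OF J]] by blast
  then have "x [^] (k * n) \<in> (ideal_sharp R ^^ l) (ideal_pow R J (k * n))"
    using x by (simp add: nat_pow_pow ideal_pow_pow[OF J])
  moreover have "k * n > 0" using k n by simp
  ultimately show ?thesis unfolding natural_iff[OF J] using x by blast
qed

end

section \<open>The root closure of the Rees algebra\<close>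

context UP_cring
begin

lemma natural_grading:
  assumes I: "ideal I R"
  shows "root_closed_grading R (\<lambda>n. ideal_natural R (ideal_pow R I n))"
proof (intro root_closed_grading.intro root_closed_grading_axioms.intro
    graded_subalgebra.intro graded_subalgebra_axioms.intro UP_cring_axioms)
  fix n
  show "additive_subgroup (ideal_natural R (ideal_pow R I n)) R"
    by (intro R.natural_additive_subgroup R.ideal_pow_ideal I)
next
  fix a b m n
  assume "a \<in> ideal_natural R (ideal_pow R I m)" "b \<in> ideal_natural R (ideal_pow R I n)"
  from R.natural_mult[OF R.ideal_pow_ideal[OF I] R.ideal_pow_ideal[OF I] this]
  show "a \<otimes> b \<in> ideal_natural R (ideal_pow R I (m + n))" by (simp add: R.ideal_pow_add[OF I])
next
  show "\<one> \<in> ideal_natural R (ideal_pow R I 0)"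
    using R.subset_natural[OF R.oneideal] by (auto simp: ideal_pow_simps)
next
  fix a d and n :: nat
  assume "a \<in> carrier R" "n > 0" "a [^] n \<in> ideal_natural R (ideal_pow R I (d * n))"
  then show "a \<in> ideal_natural R (ideal_pow R I d)"
    using R.natural_root[OF R.ideal_pow_ideal[OF I, of d]] by (simp add: R.ideal_pow_pow[OF I])
qed

text \<open>Because \<open>D\<close> contains the constants, the coefficients occurring in a fixed degree are closed under
  multiplication by ring elements; so statements about them can be checked on ideal generators.\<close>

lemma coefficient_ideal:
  assumes D: "subring D P" and const: "\<And>a. a \<in> carrier R \<Longrightarrow> monom P a 0 \<in> D"
  shows "ideal {x \<in> carrier R. monom P x n \<in> D} R"
proof (rule idealI[OF R.ring_axioms])
  show "subgroup {x \<in> carrier R. monom P x n \<in> D} (add_monoid R)"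
    by (rule R.add.subgroupI)
      (use subringE[OF D] in \<open>auto simp flip: a_inv_def intro!: exI[of _ \<zero>]\<close>)
next
  fix a x assume "a \<in> {x \<in> carrier R. monom P x n \<in> D}" and x: "x \<in> carrier R"
  then have a: "a \<in> carrier R" "monom P a n \<in> D" by auto
  have "monom P x 0 \<otimes>\<^bsub>P\<^esub> monom P a n \<in> D" by (intro subringE(6)[OF D] const x a(2))
  then have "monom P (x \<otimes> a) n \<in> D" using a x by (simp flip: monom_mult)
  then show "x \<otimes> a \<in> {x \<in> carrier R. monom P x n \<in> D}"
    "a \<otimes> x \<in> {x \<in> carrier R. monom P x n \<in> D}"
    using a x by (simp_all add: R.m_comm)
qed

lemma monom_ideal_pow_mem:
  assumes D: "subring D P" and J: "ideal J R" and JD: "\<And>x. x \<in> J \<Longrightarrow> monom P x n \<in> D"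
    and const: "\<And>a. a \<in> carrier R \<Longrightarrow> monom P a 0 \<in> D"
    and x: "x \<in> ideal_pow R J k"
  shows "monom P x (n * k) \<in> D"
  using x
proof (induct k arbitrary: x)
  case 0
  then show ?case using const by (simp add: ideal_pow_simps)
next
  case (Suc k)
  note DE = subringE[OF D]
  from Suc.prems have "x \<in> ideal_pow R J k \<cdot> J" by (simp add: ideal_pow_simps)
  then have "x \<in> carrier R \<and> monom P x (n * Suc k) \<in> D"
  proof induct
    case (prod i j)
    have ij: "i \<in> carrier R" "j \<in> carrier R"
      using prod ideal.Icarr[OF R.ideal_pow_ideal[OF J]] ideal.Icarr[OF J] by blast+
    have "monom P i (n * k) \<otimes>\<^bsub>P\<^esub> monom P j n \<in> D"
      using Suc.hyps prod JD DE(6) by blast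
    then show ?case using ij by (simp add: add.commute flip: monom_mult)
  next
    case (sum s t)
    then show ?case using DE(7) by auto
  qed
  then show ?case by blast
qed

text \<open>A generator \<open>y\<close> of the sharp of \<open>K\<close> has \<open>y\<^sup>k \<in> K\<^sup>k\<close>, hence \<open>(y t\<^sup>n)\<^sup>k \<in> (K t\<^sup>n)\<^sup>k \<subseteq> D\<close>, and \<open>D\<close> is
  root closed.\<close>

lemma monom_sharp_mem:
  assumes D: "subring D P" and root: "root_closed P D"
    and const: "\<And>a. a \<in> carrier R \<Longrightarrow> monom P a 0 \<in> D"
    and J: "ideal J R" and JD: "\<And>x. x \<in> J \<Longrightarrow> monom P x n \<in> D"
    and x: "x \<in> (ideal_sharp R ^^ l) J"
  shows "monom P x n \<in> D"
  using x
proof (induct l arbitrary: x)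
  case 0
  then show ?case using JD by simp
next
  case (Suc l)
  let ?K = "(ideal_sharp R ^^ l) J"
  have "ideal_sharp R ?K \<subseteq> {x \<in> carrier R. monom P x n \<in> D}"
  proof (rule R.sharp_subset[OF coefficient_ideal[OF D const]])
    fix y and k :: nat
    assume y: "y \<in> carrier R" and k: "k > 0" and yk: "y [^] k \<in> ideal_pow R ?K k"
    have "monom P (y [^] k) (n * k) \<in> D"
      by (rule monom_ideal_pow_mem[OF D R.iterated_sharp_ideal[OF J] Suc.hyps const yk])
    then have "monom P y n [^]\<^bsub>P\<^esub> k \<in> D" using y by (simp add: monom_pow)
    then show "y \<in> {x \<in> carrier R. monom P x n \<in> D}"
      using root y k unfolding root_closed_def by (auto simp: Suc_le_eq)
  qed
  then show ?case using Suc.prems by auto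
qed

lemma monom_natural_mem:
  assumes D: "subring D P" and root: "root_closed P D" and I: "ideal I R"
    and rees: "rees_algebra R I \<subseteq> D" and x: "x \<in> ideal_natural R (ideal_pow R I n)"
  shows "monom P x n \<in> D"
proof -
  have base: "monom P a m \<in> D" if a: "a \<in> ideal_pow R I m" for a m
  proof -
    have "a \<in> carrier R" using a ideal.Icarr[OF R.ideal_pow_ideal[OF I]] by blast
    moreover have "\<zero> \<in> ideal_pow R I i" for i
      by (rule additive_subgroup.zero_closed[OF ideal.axioms(1)[OF R.ideal_pow_ideal[OF I]]])
    ultimately have "monom P a m \<in> rees_algebra R I"
      using a by (auto simp: rees_algebra_def graded_sum_def simp flip: P_def)
    then show ?thesis using rees by blast
  qed
  have const: "monom P a 0 \<in> D" if "a \<in> carrier R" for a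
    using that by (intro base) (simp add: ideal_pow_simps)
  from x obtain k l where xc: "x \<in> carrier R" and k: "k > 0"
    and xk: "x [^] (k::nat) \<in> (ideal_sharp R ^^ l) (ideal_pow R (ideal_pow R I n) k)"
    unfolding R.natural_iff[OF R.ideal_pow_ideal[OF I]] by blast
  have "monom P (x [^] k) (n * k) \<in> D"
    by (rule monom_sharp_mem[OF D root const R.ideal_pow_ideal[OF I] base xk[unfolded R.ideal_pow_pow[OF I]]])
  then have "monom P x n [^]\<^bsub>P\<^esub> k \<in> D" using xc by (simp add: monom_pow)
  then show ?thesis using root xc k unfolding root_closed_def by (auto simp: Suc_le_eq)
qed

end

theorem theorem3p1:
  fixes A :: "('a, 'b) ring_scheme" and I :: "'a set"
  assumes "cring A" and "ideal I A"
  shows "graded_sum A (\<lambda>n. ideal_natural A (ideal_pow A I n))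
       = root_closure (UP A) (rees_algebra A I)"
proof -
  interpret UP_cring A "UP A" by (simp_all add: UP_cring_def assms(1))
  let ?J = "\<lambda>n. ideal_natural A (ideal_pow A I n)"
  interpret root_closed_grading A "UP A" ?J
    by (rule natural_grading[OF assms(2)]) simp
  show ?thesis
  proof
    show "root_closure (UP A) (rees_algebra A I) \<subseteq> S"
    proof (rule root_closure_least[OF S_subring _ graded_sum_root_closed])
      show "rees_algebra A I \<subseteq> S"
        unfolding rees_algebra_def graded_sum_def
        using R.subset_natural[OF R.ideal_pow_ideal[OF assms(2)]] by blast
    qed
    show "S \<subseteq> root_closure (UP A) (rees_algebra A I)"
      unfolding root_closure_def
    proof (intro subsetI InterI)
      fix f D assume f: "f \<in> S"
        and "D \<in> {D. subring D (UP A) \<and> rees_algebra A I \<subseteq> D \<and> root_closed (UP A) D}"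
      then have D: "subring D (UP A)" "rees_algebra A I \<subseteq> D" "root_closed (UP A) D" by auto
      show "f \<in> D"
      proof (rule mem_if_components_mem[OF D(1)])
        show "f \<in> carrier (UP A)" using f graded_sum_iff by blast
        show "monom (UP A) (coeff (UP A) f d) d \<in> D" for d
          using f graded_sum_iff by (intro monom_natural_mem[OF D(1,3) assms(2) D(2)]) blast
      qed
    qed
  qed
qed

end
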